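(* Let $K=\mathbb C^n$. The unitary elements of $\mathcal G$ (unitary as operators on the Hilbert space $H\oplus\mathbb C^n$) are of the form $\begin{bmatrix} U & 0\\ 0 & V\end{bmatrix}$ where $U\in U(H)$ and $V\in U(\mathbb C^n)$.
   Context: $H$ is a complex Hilbert space and $K=\mathbb C^n$; $H$ and $K$ have different (Hilbert) dimensions. $U(H)$, $U(\mathbb C^n)$ are the unitary groups. $\mathcal G$ is the group of all bijective linear operators on $H\oplus K$ that preserve the Hermitian form $\mathcal S((h_1,k_1),(h_2,k_2))=\langle h_1,h_2\rangle-\langle k_1,k_2\rangle$. *)

theory Defs
  imports "HOL-Analysis.Analysis" "HOL-Library.Equipollence"
begin

class complex_vector = real_vector +
  fixes scaleC :: "complex \<Rightarrow> 'a \<Rightarrow> 'a"  (infixr "*\<^sub>C" 75)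
  assumes scaleC_add_right: "a *\<^sub>C (x + y) = a *\<^sub>C x + a *\<^sub>C y"
    and scaleC_add_left: "(a + b) *\<^sub>C x = a *\<^sub>C x + b *\<^sub>C x"
    and scaleC_scaleC: "a *\<^sub>C b *\<^sub>C x = (a * b) *\<^sub>C x"
    and scaleR_scaleC: "r *\<^sub>R x = complex_of_real r *\<^sub>C x"

text \<open>Inner products are linear in the first and conjugate-linear in the second argument.\<close>

class complex_inner = complex_vector + real_normed_vector +
  fixes cinner :: "'a \<Rightarrow> 'a \<Rightarrow> complex"
  assumes cinner_commute: "cinner x y = cnj (cinner y x)"
    and cinner_add_left: "cinner (x + y) z = cinner x z + cinner y z"
    and cinner_scaleC_left: "cinner (a *\<^sub>C x) y = a * cinner x y"
    and cinner_self_norm: "cinner x x = complex_of_real ((norm x)\<^sup>2)"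

class chilbert_space = complex_inner + complete_space

lemma vector_space_scaleC: "vector_space (scaleC :: complex \<Rightarrow> 'a::complex_vector \<Rightarrow> 'a)"
proof
  fix x :: 'a
  show "1 *\<^sub>C x = x" using scaleR_scaleC[of 1 x] by simp
qed (simp_all add: scaleC_add_right scaleC_add_left scaleC_scaleC)

instantiation complex :: chilbert_space
begin
definition scaleC_complex_def: "a *\<^sub>C (x::complex) = a * x"
definition cinner_complex_def: "cinner (x::complex) y = x * cnj y"
instance
proof
  show "cinner x x = complex_of_real ((norm x)\<^sup>2)" for x :: complex
    unfolding cinner_complex_def by (rule complex_norm_square[symmetric])
qed (simp_all add: scaleC_complex_def cinner_complex_def algebra_simps scaleR_conv_of_real)
end

instantiation vec :: (complex_vector, finite) complex_vector
begin
definition scaleC_vec_def: "a *\<^sub>C (x::'a ^ 'b) = (\<chi> i. a *\<^sub>C (x $ i))"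
instance
  by standard (auto simp: scaleC_vec_def vec_eq_iff scaleC_add_right scaleC_add_left
      scaleC_scaleC scaleR_scaleC)
end

instantiation vec :: (complex_inner, finite) complex_inner
begin
definition cinner_vec_def: "cinner (x::'a ^ 'b) y = (\<Sum>i\<in>UNIV. cinner (x $ i) (y $ i))"
instance
proof
  fix x y z :: "'a ^ 'b" and a :: complex
  show "cinner x y = cnj (cinner y x)"
    unfolding cinner_vec_def cnj_sum by (intro sum.cong refl cinner_commute)
  show "cinner (x + y) z = cinner x z + cinner y z"
    by (simp add: cinner_vec_def cinner_add_left sum.distrib)
  show "cinner (a *\<^sub>C x) y = a * cinner x y"
    by (simp add: cinner_vec_def scaleC_vec_def cinner_scaleC_left sum_distrib_left)
  show "cinner x x = complex_of_real ((norm x)\<^sup>2)"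
    by (simp add: cinner_vec_def cinner_self_norm norm_vec_def L2_set_def sum_nonneg)
qed
end

instance vec :: (chilbert_space, finite) chilbert_space ..

instantiation prod :: (complex_vector, complex_vector) complex_vector
begin
definition scaleC_prod_def: "a *\<^sub>C (x::'a \<times> 'b) = (a *\<^sub>C fst x, a *\<^sub>C snd x)"
instance
  by standard (auto simp: scaleC_prod_def prod_eq_iff scaleC_add_right scaleC_add_left
      scaleC_scaleC scaleR_scaleC)
end

instantiation prod :: (complex_inner, complex_inner) complex_inner
begin
definition cinner_prod_def:
  "cinner (x::'a \<times> 'b) y = cinner (fst x) (fst y) + cinner (snd x) (snd y)"
instance
proof
  fix x y z :: "'a \<times> 'b" and a :: complex
  show "cinner x y = cnj (cinner y x)"
    unfolding cinner_prod_def complex_cnj_add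
    using cinner_commute[of "fst x" "fst y"] cinner_commute[of "snd x" "snd y"] by simp
  show "cinner (x + y) z = cinner x z + cinner y z"
    by (simp add: cinner_prod_def cinner_add_left)
  show "cinner (a *\<^sub>C x) y = a * cinner x y"
    by (simp add: cinner_prod_def scaleC_prod_def cinner_scaleC_left algebra_simps)
  show "cinner x x = complex_of_real ((norm x)\<^sup>2)"
    by (simp add: cinner_prod_def cinner_self_norm norm_prod_def)
qed
end

instance prod :: (chilbert_space, chilbert_space) chilbert_space ..

abbreviation clinear :: "('a::complex_vector \<Rightarrow> 'b::complex_vector) \<Rightarrow> bool" where
  "clinear \<equiv> Vector_Spaces.linear scaleC scaleC"

lemma clinear_iff:
  "clinear T \<longleftrightarrow> (\<forall>x y. T (x + y) = T x + T y) \<and> (\<forall>a x. T (a *\<^sub>C x) = a *\<^sub>C T x)"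
  by (simp add: Vector_Spaces.linear_iff vector_space_scaleC)

definition unitary_group :: "('a::chilbert_space \<Rightarrow> 'a) set" where
  "unitary_group = {U. clinear U \<and> bij U \<and> (\<forall>x y. cinner (U x) (U y) = cinner x y)}"

lemma unitary_group_iff_adjoint:
  "U \<in> unitary_group \<longleftrightarrow>
     clinear U \<and> (\<exists>V. clinear V \<and> (\<forall>x y. cinner (U x) y = cinner x (V y)) \<and> V \<circ> U = id \<and> U \<circ> V = id)"
  (is "_ \<longleftrightarrow> ?R")
proof
  assume "U \<in> unitary_group"
  then have lin: "clinear U" and bij: "bij U"
    and iso: "\<And>x y. cinner (U x) (U y) = cinner x y"
    by (auto simp: unitary_group_def)
  have inv: "U (inv U x) = x" "inv U (U x) = x" for x
    using bij by (simp_all add: bij_is_surj bij_is_inj surj_f_inv_f)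
  have "inv U (x + y) = inv U x + inv U y" for x y
    using lin inv(1)[of x] inv(1)[of y] inv(2)[of "inv U x + inv U y"] by (simp add: clinear_iff)
  moreover have "inv U (a *\<^sub>C x) = a *\<^sub>C inv U x" for a x
    using lin inv(1)[of x] inv(2)[of "a *\<^sub>C inv U x"] by (simp add: clinear_iff)
  ultimately have "clinear (inv U)"
    by (simp add: clinear_iff)
  moreover have "cinner (U x) y = cinner x (inv U y)" for x y
    using iso[of x "inv U y"] inv by simp
  ultimately show ?R
    using lin inv by (intro conjI exI[of _ "inv U"]) auto
next
  assume ?R
  then obtain V where V: "clinear U" "\<And>x y. cinner (U x) y = cinner x (V y)"
    "V \<circ> U = id" "U \<circ> V = id" by blast
  from V(3) have "V (U x) = x" for x by (simp add: fun_eq_iff)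
  with V show "U \<in> unitary_group"
    by (auto simp: unitary_group_def intro: o_bij)
qed

text \<open>An orthonormal basis is a maximal orthonormal set; the Hilbert dimension is the
  (possibly infinite) cardinality of any such set.\<close>

definition orthonormal :: "'a::complex_inner set \<Rightarrow> bool" where
  "orthonormal B \<longleftrightarrow> (\<forall>x\<in>B. norm x = 1) \<and> pairwise (\<lambda>x y. cinner x y = 0) B"

definition orthonormal_basis :: "'a::complex_inner set \<Rightarrow> bool" where
  "orthonormal_basis B \<longleftrightarrow> orthonormal B \<and> (\<forall>C. orthonormal C \<and> B \<subseteq> C \<longrightarrow> C = B)"

definition equal_hilbert_dim :: "'a::chilbert_space itself \<Rightarrow> 'b::chilbert_space itself \<Rightarrow> bool" where
  "equal_hilbert_dim _ _ \<longleftrightarrow>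
     (\<exists>(B::'a set) (C::'b set). orthonormal_basis B \<and> orthonormal_basis C \<and> B \<approx> C)"

definition hform :: "'h::chilbert_space \<times> 'k::chilbert_space \<Rightarrow> 'h \<times> 'k \<Rightarrow> complex" where
  "hform x y = cinner (fst x) (fst y) - cinner (snd x) (snd y)"

definition hform_group :: "('h::chilbert_space \<times> 'k::chilbert_space \<Rightarrow> 'h \<times> 'k) set" where
  "hform_group = {T. clinear T \<and> bij T \<and> (\<forall>x y. hform (T x) (T y) = hform x y)}"

text \<open>The operator with block matrix \<open>[[A, B], [C, D]]\<close>.\<close>

definition block_op ::
  "('h::plus \<Rightarrow> 'h) \<Rightarrow> ('k::plus \<Rightarrow> 'h) \<Rightarrow> ('h \<Rightarrow> 'k) \<Rightarrow> ('k \<Rightarrow> 'k) \<Rightarrow> 'h \<times> 'k \<Rightarrow> 'h \<times> 'k" where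
  "block_op A B C D = (\<lambda>(h, k). (A h + B k, C h + D k))"

end

theory Submission
  imports Defs
begin

text \<open>An operator preserving both the inner product
  \<open>\<langle>h\<^sub>1, h\<^sub>2\<rangle> + \<langle>k\<^sub>1, k\<^sub>2\<rangle>\<close> and the form \<open>\<langle>h\<^sub>1, h\<^sub>2\<rangle> - \<langle>k\<^sub>1, k\<^sub>2\<rangle>\<close> preserves the two summands
  separately. Hence the second component of the image of \<open>(h, 0)\<close> and the first component of the
  image of \<open>(0, k)\<close> have norm zero, and the operator is block diagonal.\<close>

lemma cinner_zero [simp]: "cinner 0 (y::'a::complex_inner) = 0"
  using cinner_add_left[of 0 0 y] by simp

lemma cinner_self_eq_zero_iff [simp]: "cinner x x = 0 \<longleftrightarrow> (x::'a::complex_inner) = 0"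
  by (simp add: cinner_self_norm)

lemma scaleC_zero [simp]: "a *\<^sub>C (0::'a::complex_vector) = 0"
  using scaleC_add_right[of a 0 "0::'a"] by simp

text \<open>If \<open>U\<close> identifies \<open>x\<close> and \<open>y\<close>, then it kills
  \<open>x - y\<close>; since inner products are kept, \<open>x - y\<close> is orthogonal to itself
  and hence zero.\<close>

lemma isometry_inj:
  fixes U :: "'a::complex_inner \<Rightarrow> 'b::complex_inner"
  assumes "clinear U" and "\<And>x y. cinner (U x) (U y) = cinner x y"
  shows "inj U"
proof (rule injI)
  fix x y assume "U x = U y"
  moreover have "U (x - y) + U y = U x"
    using assms(1) by (metis clinear_iff diff_add_cancel)
  ultimately have "U (x - y) = 0" by simp
  then have "cinner (x - y) (x - y) = 0" by (metis assms(2) cinner_zero)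
  then show "x = y" by simp
qed

text \<open>Injectivity comes for free from the isometry property, so for the diagonal blocks below
  only surjectivity has to be checked.\<close>

lemma unitary_groupI:
  fixes U :: "'a::chilbert_space \<Rightarrow> 'a"
  assumes "clinear U" and "surj U" and "\<And>x y. cinner (U x) (U y) = cinner x y"
  shows "U \<in> unitary_group"
  using assms isometry_inj[OF assms(1,3)] by (auto simp: unitary_group_def bij_def)

lemma block_diagonal_apply:
  "block_op U (\<lambda>_. 0) (\<lambda>_. 0) V x = (U (fst x), V (snd x :: 'k::monoid_add))"
  for U :: "'h::monoid_add \<Rightarrow> 'h"
  by (simp add: block_op_def split_beta)

text \<open>The inner product and \<open>hform\<close> are the sum and the difference of the inner
  products of the components, and \<open>U\<close> and \<open>V\<close> preserve each of
  these.\<close>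

lemma block_diagonal_unitary:
  fixes U :: "'h::chilbert_space \<Rightarrow> 'h" and V :: "'k::chilbert_space \<Rightarrow> 'k"
  assumes U: "U \<in> unitary_group" and V: "V \<in> unitary_group"
  shows "block_op U (\<lambda>_. 0) (\<lambda>_. 0) V \<in> hform_group \<inter> unitary_group"
proof -
  let ?T = "block_op U (\<lambda>_. 0) (\<lambda>_. 0) V"
  have "clinear ?T"
    using U V by (simp add: unitary_group_def clinear_iff block_diagonal_apply scaleC_prod_def)
  moreover have "bij ?T"
  proof -
    \<comment> \<open>As a product map, the operator inherits injectivity and surjectivity from its
      factors.\<close>
    have "?T = map_prod U V"
      by (simp add: fun_eq_iff block_diagonal_apply)
    moreover have "bij U" "bij V" using U V by (auto simp: unitary_group_def)
    ultimately show ?thesis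
      by (simp add: bij_def map_prod_surj prod.inj_map)
  qed
  ultimately show ?thesis
    using U V by (simp add: unitary_group_def hform_group_def hform_def cinner_prod_def
        block_diagonal_apply)
qed

lemma hform_unitary_block_diagonal:
  fixes T :: "'h::chilbert_space \<times> 'k::chilbert_space \<Rightarrow> 'h \<times> 'k"
  assumes "T \<in> hform_group \<inter> unitary_group"
  obtains U V where "U \<in> unitary_group" and "V \<in> unitary_group"
    and "T = block_op U (\<lambda>_. 0) (\<lambda>_. 0) V"
proof -
  have add: "T (x + y) = T x + T y" and scale: "T (a *\<^sub>C x) = a *\<^sub>C T x" for a x y
    using assms by (auto simp: unitary_group_def clinear_iff simp del: split_paired_All)
  have surj: "surj T"
    using assms by (auto simp: unitary_group_def bij_def)
  have sum: "cinner (fst (T x)) (fst (T y)) + cinner (snd (T x)) (snd (T y))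
      = cinner (fst x) (fst y) + cinner (snd x) (snd y)"
    and diff: "cinner (fst (T x)) (fst (T y)) - cinner (snd (T x)) (snd (T y))
      = cinner (fst x) (fst y) - cinner (snd x) (snd y)" for x y
  proof -
    have "cinner (T x) (T y) = cinner x y" and "hform (T x) (T y) = hform x y"
      using assms unfolding unitary_group_def hform_group_def by blast+
    then show "cinner (fst (T x)) (fst (T y)) + cinner (snd (T x)) (snd (T y))
        = cinner (fst x) (fst y) + cinner (snd x) (snd y)"
      and "cinner (fst (T x)) (fst (T y)) - cinner (snd (T x)) (snd (T y))
        = cinner (fst x) (fst y) - cinner (snd x) (snd y)"
      by (simp_all add: hform_def cinner_prod_def)
  qed
  \<comment> \<open>Adding \<open>sum\<close> and \<open>diff\<close> gives twice this
    identity.\<close>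
  have fst: "cinner (fst (T x)) (fst (T y)) = cinner (fst x) (fst y)" for x y
    using sum[of x y] diff[of x y] by algebra
  have snd: "cinner (snd (T x)) (snd (T y)) = cinner (snd x) (snd y)" for x y
    using sum[of x y] fst[of x y] by simp
  \<comment> \<open>The diagonal blocks of \<open>T\<close>: restrict to one summand, then project
    back onto it.\<close>
  define U where "U h = fst (T (h, 0))" for h
  define V where "V k = snd (T (0, k))" for k
  \<comment> \<open>By \<open>snd\<close>, this vector has the same inner product with itself as the
    second component of \<open>(h, 0)\<close>, namely 0.\<close>
  have "snd (T (h, 0)) = 0" for h
    using snd[of "(h, 0)" "(h, 0)"] by simp
  moreover have "fst (T (0, k)) = 0" for k
    using fst[of "(0, k)" "(0, k)"] by simp
  \<comment> \<open>Split \<open>(h, k)\<close> as \<open>(h, 0) + (0, k)\<close>; the off-diagonal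
    contributions have just been shown to vanish.\<close>
  ultimately have T: "T (h, k) = (U h, V k)" for h k
    using add[of "(h, 0)" "(0, k)"] by (simp add: U_def V_def prod_eq_iff)
  have "U \<in> unitary_group"
  proof (rule unitary_groupI)
    have "U (x + y) = U x + U y" for x y
      using add[of "(x, 0)" "(y, 0)"] by (simp add: U_def)
    moreover have "U (a *\<^sub>C x) = a *\<^sub>C U x" for a x
      using scale[of a "(x, 0)"] by (simp add: U_def scaleC_prod_def)
    ultimately show "clinear U"
      by (simp add: clinear_iff)
    show "surj U"
      unfolding surj_def
    proof
      fix h'
      \<comment> \<open>Because \<open>T\<close> acts componentwise, the first component of any
        preimage of \<open>(h', 0)\<close> is a preimage of \<open>h'\<close> under
        \<open>U\<close>.\<close>
      obtain h k where "T (h, k) = (h', 0)"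
        using surj by (metis surjD surj_pair)
      then show "\<exists>h. h' = U h"
        using T[of h k] by auto
    qed
    show "cinner (U x) (U y) = cinner x y" for x y
      using fst[of "(x, 0)" "(y, 0)"] by (simp add: U_def)
  qed
  moreover have "V \<in> unitary_group"
  proof (rule unitary_groupI)
    have "V (x + y) = V x + V y" for x y
      using add[of "(0, x)" "(0, y)"] by (simp add: V_def)
    moreover have "V (a *\<^sub>C x) = a *\<^sub>C V x" for a x
      using scale[of a "(0, x)"] by (simp add: V_def scaleC_prod_def)
    ultimately show "clinear V"
      by (simp add: clinear_iff)
    show "surj V"
      unfolding surj_def
    proof
      fix k'
      \<comment> \<open>Symmetrically, the second component of a preimage serves for
        \<open>V\<close>.\<close>
      obtain h k where "T (h, k) = (0, k')"
        using surj by (metis surjD surj_pair)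
      then show "\<exists>k. k' = V k"
        using T[of h k] by auto
    qed
    show "cinner (V x) (V y) = cinner x y" for x y
      using snd[of "(0, x)" "(0, y)"] by (simp add: V_def)
  qed
  moreover have "T = block_op U (\<lambda>_. 0) (\<lambda>_. 0) V"
    by (simp add: fun_eq_iff T block_diagonal_apply)
  ultimately show ?thesis by (rule that)
qed

theorem proposition1p2:
  assumes "\<not> equal_hilbert_dim TYPE('h::chilbert_space) TYPE(complex ^ 'n::finite)"
  shows "(hform_group :: ('h \<times> (complex ^ 'n) \<Rightarrow> 'h \<times> (complex ^ 'n)) set) \<inter> unitary_group =
    {block_op U (\<lambda>_. 0) (\<lambda>_. 0) V | U V. U \<in> unitary_group \<and> V \<in> unitary_group}"
proof (intro equalityI subsetI)
  fix T :: "'h \<times> (complex ^ 'n) \<Rightarrow> 'h \<times> (complex ^ 'n)"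
  assume "T \<in> hform_group \<inter> unitary_group"
  then show "T \<in> {block_op U (\<lambda>_. 0) (\<lambda>_. 0) V | U V. U \<in> unitary_group \<and> V \<in> unitary_group}"
    by (rule hform_unitary_block_diagonal) blast
next
  fix T :: "'h \<times> (complex ^ 'n) \<Rightarrow> 'h \<times> (complex ^ 'n)"
  assume "T \<in> {block_op U (\<lambda>_. 0) (\<lambda>_. 0) V | U V. U \<in> unitary_group \<and> V \<in> unitary_group}"
  then obtain U V where "T = block_op U (\<lambda>_. 0) (\<lambda>_. 0) V"
    and "U \<in> unitary_group" "V \<in> unitary_group" by blast
  then show "T \<in> hform_group \<inter> unitary_group"
    using block_diagonal_unitary by simp
qed

end
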